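(* Let $\mathbb{D}^*=\mathbb{D}\setminus\{0\}$, let $\psi:\mathbb{D}^*\to\mathbb{D}^*$ be holomorphic and surjective, and let $\omega\in H(\mathbb{D}^* )$. Then $C_{\omega,\psi}$ is not supercyclic on $H(\mathbb{D}^* )$.
   Context: $\mathbb{D}=\{z\in\mathbb{C}:|z|<1\}$. $H(\mathbb{D}^* )$ is the space of holomorphic functions on $\mathbb{D}^*$ with the compact-open topology. The weighted composition operator $C_{\omega,\psi}:H(\mathbb{D}^* )\to H(\mathbb{D}^* )$ is $C_{\omega,\psi}(f)(z)=\omega(z)\,f(\psi(z))$. An operator (continuous linear self-map) $T$ on a topological vector space $X$ is supercyclic if for some $f\in X$ the set $\{\lambda T^nf:\lambda\in\mathbb{C},\ n=0,1,\dots\}$ is dense in $X$. *)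

theory Defs
  imports "HOL-Complex_Analysis.Complex_Analysis"
begin

definition punctured_disc :: "complex set" where
  "punctured_disc = ball 0 1 - {0}"

text \<open>Elements of \<open>H(S)\<close> are represented by their extension by zero to all of \<open>\<complex>\<close>, so that each
  holomorphic function on \<open>S\<close> has exactly one representative and \<open>H(S)\<close> is closed under the
  pointwise linear operations on \<open>complex \<Rightarrow> complex\<close>.\<close>

definition holo_space :: "complex set \<Rightarrow> (complex \<Rightarrow> complex) set" where
  "holo_space S = {f. f holomorphic_on S \<and> (\<forall>z. z \<notin> S \<longrightarrow> f z = 0)}"

definition compact_open_topology :: "complex set \<Rightarrow> (complex \<Rightarrow> complex) topology" where
  "compact_open_topology S = topology_generated_by
     {{f \<in> holo_space S. f ` K \<subseteq> U} | K U. compact K \<and> K \<subseteq> S \<and> open U}"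

lemma topspace_compact_open_topology: "topspace (compact_open_topology S) = holo_space S"
proof -
  have "holo_space S \<in> {{f \<in> holo_space S. f ` K \<subseteq> U} | K U. compact K \<and> K \<subseteq> S \<and> open U}"
    by (rule CollectI, rule exI[of _ "{}"], rule exI[of _ UNIV]) auto
  then show ?thesis
    unfolding compact_open_topology_def topology_generated_by_topspace by blast
qed

definition weighted_comp ::
  "complex set \<Rightarrow> (complex \<Rightarrow> complex) \<Rightarrow> (complex \<Rightarrow> complex) \<Rightarrow> (complex \<Rightarrow> complex) \<Rightarrow> complex \<Rightarrow> complex"
  where "weighted_comp S \<omega> \<psi> f = (\<lambda>z. if z \<in> S then \<omega> z * f (\<psi> z) else 0)"

lemma weighted_comp_in_holo_space:
  assumes "\<omega> holomorphic_on S" "\<psi> holomorphic_on S" "\<psi> ` S \<subseteq> S" "f \<in> holo_space S"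
  shows "weighted_comp S \<omega> \<psi> f \<in> holo_space S"
proof -
  have "(f \<circ> \<psi>) holomorphic_on S"
    using assms by (intro holomorphic_on_compose_gen[of \<psi> S f S]) (auto simp: holo_space_def)
  with assms(1) have "(\<lambda>z. \<omega> z * (f \<circ> \<psi>) z) holomorphic_on S"
    by (rule holomorphic_on_mult)
  then have "weighted_comp S \<omega> \<psi> f holomorphic_on S"
    by (rule holomorphic_transform) (simp add: weighted_comp_def)
  then show ?thesis
    by (simp add: holo_space_def weighted_comp_def)
qed

text \<open>The vector space is carried by the topological space \<open>X\<close>, with scalar multiplication
  \<open>smul\<close>. That \<open>T\<close> is a continuous linear self-map of \<open>X\<close> is not part of the definition, so
  the negation of \<open>supercyclic\<close> cannot hold merely because \<open>T\<close> fails to be an operator.\<close>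

definition supercyclic :: "(complex \<Rightarrow> 'v \<Rightarrow> 'v) \<Rightarrow> 'v topology \<Rightarrow> ('v \<Rightarrow> 'v) \<Rightarrow> bool" where
  "supercyclic smul X T \<longleftrightarrow>
     (\<exists>f \<in> topspace X. X closure_of {smul c ((T ^^ n) f) | c n. True} = topspace X)"

end

theory Submission
  imports Defs
begin

text \<open>Write \<open>T\<close> for the operator, \<open>D\<close> for the punctured disc, and suppose that the multiples of the
  orbit \<open>T\<^sup>n f\<close> are dense.

  A continuous linear functional that vanishes on \<open>T\<^sup>n f\<close> for all \<open>n \<ge> 1\<close> is zero, since otherwise
  these multiples would all lie in the union of a line and a hyperplane, which is closed and is not
  the whole space. If \<open>\<omega>\<close> had a zero
  \<open>z\<close>, evaluation at \<open>z\<close> would be such a functional, and if \<open>\<psi> z = \<psi> w\<close> with \<open>z \<noteq> w\<close>, then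
  \<open>g \<mapsto> \<omega> w * g z - \<omega> z * g w\<close> would be one (\<open>orbit_two_point_relation_trivial\<close>). So \<open>\<omega>\<close> is
  zero-free and \<open>\<psi>\<close> is injective.

  Surjectivity now makes \<open>\<psi>\<close> an automorphism of \<open>D\<close>. It extends to an automorphism of the disc
  that fixes the origin, so by the Schwarz lemma it is a rotation
  (\<open>punctured_disc_automorphism_rotation\<close>).

  For a rotation the obstruction is topological. Choose a circle around the origin on which \<open>f\<close> has
  no zeros, and let \<open>ind g\<close> be the winding number about \<open>0\<close> of the image of that circle under \<open>g\<close>.
  It is additive on products and insensitive to rotations, so
  \<open>ind (T\<^sup>n f) = n * ind \<omega> + ind f\<close> (\<open>weighted_rotation_index\<close>), and density says that every
  holomorphic \<open>g\<close> without zeros on the circle has one of these numbers as its index. For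
  \<open>g = f / \<omega>\<close> the index is \<open>ind f - ind \<omega>\<close>, which forces \<open>(n + 1) * ind \<omega> = 0\<close>, that is,
  \<open>ind \<omega> = 0\<close>. Then only the value \<open>ind f\<close> is available, whereas \<open>g = (\<lambda>z. z * f z)\<close> has index
  \<open>ind f + 1\<close>.\<close>

section \<open>Approximation by a dense orbit\<close>

text \<open>The generating sets of the topology control one compact set and one open target each, so a uniform
  estimate takes finitely many of them: cover \<open>K\<close> by small balls on which \<open>g\<close> oscillates by less
  than \<open>e / 2\<close>, and ask \<open>h\<close> to map each of these pieces close to the value of \<open>g\<close> at its centre.\<close>
lemma compact_open_approximation:
  assumes dense: "compact_open_topology S closure_of A = holo_space S"
    and g: "g \<in> holo_space S" and K: "compact K" "K \<subseteq> S" and "0 < e"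
  obtains h where "h \<in> A" "\<And>z. z \<in> K \<Longrightarrow> cmod (h z - g z) < e"
proof -
  have contg: "continuous_on K g"
    using g K(2) by (auto simp: holo_space_def intro: holomorphic_on_imp_continuous_on continuous_on_subset)
  have "\<exists>d>0. \<forall>y\<in>K. dist y x < d \<longrightarrow> dist (g y) (g x) < e / 2" if "x \<in> K" for x
    using contg that \<open>0 < e\<close> unfolding continuous_on_iff by (meson half_gt_zero)
  then obtain d where d: "\<And>x. x \<in> K \<Longrightarrow> 0 < d x"
      "\<And>x y. x \<in> K \<Longrightarrow> y \<in> K \<Longrightarrow> dist y x < d x \<Longrightarrow> dist (g y) (g x) < e / 2"
    by metis
  obtain F where F: "finite F" "F \<subseteq> K" "K \<subseteq> (\<Union>x\<in>F. ball x (d x / 2))"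
  proof -
    have "K \<subseteq> (\<Union>x\<in>K. ball x (d x / 2))"
      using d(1) by force
    then show ?thesis
      using compactE_image[OF K(1), of K "\<lambda>x. ball x (d x / 2)"] that by (metis open_ball)
  qed
  define V where "V x = {h \<in> holo_space S. h ` (K \<inter> cball x (d x / 2)) \<subseteq> ball (g x) (e / 2)}" for x
  have V: "openin (compact_open_topology S) (V x)" for x
    unfolding compact_open_topology_def V_def
    by (rule topology_generated_by_Basis) (use K in \<open>auto simp: compact_Int_closed\<close>)
  have gV: "g \<in> V x" if "x \<in> F" for x
  proof -
    have x: "x \<in> K"
      using F(2) that by blast
    have "dist (g x) (g y) < e / 2" if "y \<in> K" "dist x y \<le> d x / 2" for y
    proof -
      have "dist y x < d x"
        using that d(1)[OF x] by (simp add: dist_commute)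
      then show ?thesis
        using d(2)[OF x] that by (metis dist_commute)
    qed
    then show ?thesis
      using g by (auto simp: V_def)
  qed
  have "openin (compact_open_topology S) ((\<Inter>x\<in>F. V x) \<inter> topspace (compact_open_topology S))"
    using F(1) V by (rule openin_INT)
  moreover have "g \<in> (\<Inter>x\<in>F. V x) \<inter> topspace (compact_open_topology S)"
    using gV g by (simp add: topspace_compact_open_topology)
  ultimately obtain h where h: "h \<in> A" "h \<in> (\<Inter>x\<in>F. V x)"
    using g unfolding dense[symmetric] in_closure_of by blast
  show thesis
  proof (rule that[OF h(1)])
    fix z assume z: "z \<in> K"
    then obtain x where x: "x \<in> F" "dist x z < d x / 2"
      using F(3) by auto
    then have "z \<in> K \<inter> cball x (d x / 2)"
      using z by simp
    then have "h z \<in> ball (g x) (e / 2)" "g z \<in> ball (g x) (e / 2)"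
      using h(2) gV[OF x(1)] x(1) unfolding V_def by blast+
    then have "dist (g x) (h z) < e / 2" "dist (g x) (g z) < e / 2"
      by simp_all
    then show "cmod (h z - g z) < e"
      by (metis dist_norm dist_triangle_half_r)
  qed
qed

text \<open>The functional \<open>h \<mapsto> a * h z + b * h w\<close> kills all members of the sequence after the first. If
  \<open>a \<noteq> 0\<close>, functions that vanish at \<open>w\<close> but not at \<open>z\<close> must therefore be approximated by multiples of \<open>F 0\<close> alone. This is
  impossible, because a third point \<open>p\<close> leaves room to prescribe the ratio of the values at \<open>z\<close> and
  \<open>p\<close> differently from that of \<open>F 0\<close>.\<close>
lemma orbit_two_point_relation_trivial:
  fixes F :: "nat \<Rightarrow> complex \<Rightarrow> complex"
  assumes dense: "compact_open_topology S closure_of {\<lambda>u. c * F n u | c n. True} = holo_space S"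
    and S: "open S" "z \<in> S" "w \<in> S" "z \<noteq> w"
    and rel: "\<And>n. 1 \<le> n \<Longrightarrow> a * F n z + b * F n w = 0"
  shows "a = 0"
proof (rule ccontr)
  assume a: "a \<noteq> 0"
  obtain p where p: "p \<in> S" "p \<noteq> z" "p \<noteq> w"
  proof -
    have "infinite S"
      using S finite_imp_not_open by blast
    then have "\<not> S \<subseteq> {z, w}"
      using finite_subset by blast
    then show thesis using that by auto
  qed
  \<comment> \<open>The bound \<open>d\<close> is at most the distance, measured by the values at \<open>z\<close> and \<open>w\<close>, from \<open>q\<close> to the
    kernel of the functional; this leaves only \<open>n = 0\<close>.\<close>
  have initial: "\<exists>c. cmod (c * F 0 z - q z) < e \<and> cmod (c * F 0 p - q p) < e"
    if q: "q holomorphic_on S" "q w = 0" "q z \<noteq> 0" and e: "0 < e" for q e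
  proof -
    define d where "d = min e (cmod (a * q z) / (cmod a + cmod b))"
    have ab: "0 < cmod a + cmod b"
      using a by (simp add: add_pos_nonneg)
    then have d: "0 < d"
      using a q(3) e by (simp add: d_def)
    have "(\<lambda>u. if u \<in> S then q u else 0) \<in> holo_space S"
      using q(1) by (auto simp: holo_space_def intro: holomorphic_transform)
    then obtain h where h: "h \<in> {\<lambda>u. c * F n u | c n. True}"
        "\<And>u. u \<in> {z, w, p} \<Longrightarrow> cmod (h u - (if u \<in> S then q u else 0)) < d"
      by (rule compact_open_approximation[OF dense _ _ _ d, of _ "{z, w, p}"]) (use S p in auto)
    then obtain c n where cn: "h = (\<lambda>u. c * F n u)"
      by auto
    have close: "cmod (c * F n z - q z) < d" "cmod (c * F n w) < d" "cmod (c * F n p - q p) < d"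
      using h(2)[of z] h(2)[of w] h(2)[of p] S p q(2) by (auto simp: cn)
    have "n = 0"
    proof (rule ccontr)
      assume "n \<noteq> 0"
      then have "c * (a * F n z + b * F n w) = 0"
        using rel[of n] by simp
      then have "a * q z = - (a * (c * F n z - q z) + b * (c * F n w))"
        by (simp add: algebra_simps eq_neg_iff_add_eq_0)
      then have "cmod (a * q z) \<le> cmod a * cmod (c * F n z - q z) + cmod b * cmod (c * F n w)"
        by (metis norm_minus_cancel norm_mult norm_triangle_ineq)
      also have "\<dots> < cmod a * d + cmod b * d"
        using close a by (intro add_less_le_mono mult_strict_left_mono mult_left_mono) auto
      also have "\<dots> = (cmod a + cmod b) * d"
        by (simp add: algebra_simps)
      also have "\<dots> \<le> (cmod a + cmod b) * (cmod (a * q z) / (cmod a + cmod b))"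
        unfolding d_def by (rule mult_left_mono) auto
      also have "\<dots> = cmod (a * q z)"
        using ab by simp
      finally show False by simp
    qed
    then show ?thesis
      using close by (auto simp: d_def)
  qed
  show False
  proof (cases "F 0 p = 0")
    case True
    \<comment> \<open>All multiples of \<open>F 0\<close> vanish at \<open>p\<close>, so aim at a function that does not.\<close>
    have "\<exists>c. cmod (c * F 0 z - (z - w)) < cmod (p - w) \<and> cmod (c * F 0 p - (p - w)) < cmod (p - w)"
      using S p by (intro initial[of "\<lambda>u. u - w"]) (auto intro!: holomorphic_intros)
    then show False
      using True by (auto simp: norm_minus_commute)
  next
    case False
    \<comment> \<open>Aim at a function that vanishes at \<open>p\<close> and has the value \<open>k\<close> at \<open>z\<close>. A small value of
      \<open>c * F 0 p\<close> makes \<open>c\<close>, and so \<open>c * F 0 z\<close>, small; \<open>m\<close> measures by how much.\<close>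
    define k where "k = (z - w) * (z - p)"
    define m where "m = 1 + cmod (F 0 z) / cmod (F 0 p)"
    have m: "0 < m"
      by (simp add: m_def add_pos_nonneg)
    have k: "k \<noteq> 0"
      using S p by (auto simp: k_def)
    have "\<exists>c. cmod (c * F 0 z - (z - w) * (z - p)) < cmod k / m
        \<and> cmod (c * F 0 p - (p - w) * (p - p)) < cmod k / m"
      using k m by (intro initial[of "\<lambda>u. (u - w) * (u - p)"])
        (auto simp: k_def intro!: holomorphic_intros)
    then obtain c where c: "cmod (c * F 0 z - k) < cmod k / m" "cmod (c * F 0 p) < cmod k / m"
      by (auto simp: k_def)
    have "cmod k \<le> cmod (c * F 0 z - k) + cmod (c * F 0 z)"
      by (metis norm_minus_commute norm_triangle_sub add.commute)
    also have "cmod (c * F 0 z) = cmod (c * F 0 p) * (cmod (F 0 z) / cmod (F 0 p))"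
      using False by (simp add: norm_mult)
    also have "cmod (c * F 0 z - k) + cmod (c * F 0 p) * (cmod (F 0 z) / cmod (F 0 p))
        < cmod k / m + cmod k / m * (cmod (F 0 z) / cmod (F 0 p))"
      using c by (intro add_less_le_mono mult_right_mono) auto
    also have "\<dots> = cmod k / m * m"
      by (simp only: m_def distrib_left mult_1_right)
    also have "\<dots> = cmod k"
      using m by simp
    finally show False by simp
  qed
qed

section \<open>Automorphisms of the punctured disc\<close>

lemma open_punctured_disc: "open punctured_disc"
  by (simp add: punctured_disc_def open_delete)

lemma connected_punctured_disc: "connected punctured_disc"
  unfolding punctured_disc_def by (rule connected_open_delete) auto

text \<open>The singularity at the origin is removable because the map is bounded. By continuity the extension
  could only reach the closed disc, but its image is open and hence lies in the open disc.\<close>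
lemma injection_extends_across_puncture:
  assumes f: "f holomorphic_on punctured_disc" "inj_on f punctured_disc"
    and im: "f ` punctured_disc \<subseteq> ball 0 1"
  obtains F where "F holomorphic_on ball 0 1" "\<And>z. z \<in> punctured_disc \<Longrightarrow> F z = f z"
    "F ` ball 0 1 \<subseteq> ball 0 1"
proof -
  have ev: "eventually (\<lambda>z. z \<in> punctured_disc) (at 0)"
    unfolding eventually_at punctured_disc_def by (rule exI[of _ 1]) auto
  have "\<exists>B. eventually (\<lambda>z. cmod (f z) \<le> B) (at 0)"
    by (rule exI[of _ 1], rule eventually_mono[OF ev]) (use im in force)
  then obtain F where F: "F holomorphic_on ball 0 1" "\<And>z. z \<in> punctured_disc \<Longrightarrow> F z = f z"
    using holomorphic_on_extend_bounded[of f "ball 0 1" 0] f(1) by (auto simp: punctured_disc_def)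
  have "F \<midarrow>0\<rightarrow> F 0"
    using holomorphic_on_imp_continuous_on[OF F(1)]
    by (simp add: continuous_on_eq_continuous_at isCont_def)
  then have "F 0 \<in> cball 0 1"
    by (rule Lim_in_closed_set[rotated 3])
       (use im in \<open>force intro!: eventually_mono[OF ev] simp: F(2)\<close>)+
  then have le: "F ` ball 0 1 \<subseteq> cball 0 1"
    using F(2) im by (force simp: punctured_disc_def)
  have "\<not> F constant_on ball 0 1"
  proof
    assume "F constant_on ball 0 1"
    moreover have "1/2 \<in> punctured_disc" "1/3 \<in> punctured_disc"
      by (auto simp: punctured_disc_def norm_divide)
    ultimately have "f (1/2) = f (1/3)"
      by (auto simp: constant_on_def punctured_disc_def F(2)[symmetric])
    then show False
      using f(2) \<open>1/2 \<in> punctured_disc\<close> \<open>1/3 \<in> punctured_disc\<close> by (auto dest!: inj_onD)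
  qed
  then have "open (F ` ball 0 1)"
    using F(1) by (intro open_mapping_thm[of F "ball 0 1"]) auto
  then have "F ` ball 0 1 \<subseteq> ball 0 1"
    using interior_maximal[OF le] by simp
  with F that show thesis by blast
qed

text \<open>The identity \<open>G (F z) = z\<close> persists at the origin by continuity. If \<open>F 0\<close> were another point of
  the disc, it would have to be sent to \<open>0\<close> by \<open>G\<close>, which has no zeros away from the origin.\<close>
lemma bijection_puncture_fixed:
  assumes F: "F holomorphic_on ball 0 1" "F ` ball 0 1 \<subseteq> ball 0 1"
    and G: "G holomorphic_on ball 0 1" "G ` punctured_disc \<subseteq> punctured_disc"
    and inv: "\<And>z. z \<in> punctured_disc \<Longrightarrow> G (F z) = z"
  shows "F 0 = 0"
proof (rule ccontr)
  assume "F 0 \<noteq> 0"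
  then have F0: "F 0 \<in> punctured_disc"
    using F(2) by (force simp: punctured_disc_def)
  have "continuous_on (ball 0 1) (G \<circ> F)"
    using F G by (meson holomorphic_on_compose_gen holomorphic_on_imp_continuous_on)
  then have "(G \<circ> F) \<midarrow>0\<rightarrow> (G \<circ> F) 0"
    by (simp add: continuous_on_eq_continuous_at isCont_def del: o_apply)
  moreover have "(G \<circ> F) \<midarrow>0\<rightarrow> 0"
    by (rule Lim_transform_within_open[OF tendsto_ident_at, of "ball 0 1"])
       (auto simp: inv punctured_disc_def)
  ultimately have "G (F 0) = 0"
    using LIM_unique by fastforce
  then show False
    using F0 G(2) by (force simp: punctured_disc_def)
qed

text \<open>The map and its inverse both extend to self-maps of the disc that fix the origin. The Schwarz lemma,
  applied to both of them, gives \<open>cmod (f z) = cmod z\<close>, and its equality case gives a rotation.\<close>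
lemma punctured_disc_automorphism_rotation:
  assumes f: "f holomorphic_on punctured_disc" "inj_on f punctured_disc"
    and im: "f ` punctured_disc = punctured_disc"
  obtains \<alpha> where "cmod \<alpha> = 1" "\<And>z. z \<in> punctured_disc \<Longrightarrow> f z = \<alpha> * z"
proof -
  obtain g where g: "g holomorphic_on punctured_disc" "\<And>z. z \<in> punctured_disc \<Longrightarrow> g (f z) = z"
    using holomorphic_has_inverse[OF f(1) open_punctured_disc f(2)] im by metis
  have fg: "f (g z) = z" if "z \<in> punctured_disc" for z
    using that g(2) im by force
  have gim: "g ` punctured_disc = punctured_disc"
  proof -
    have "g ` f ` punctured_disc = punctured_disc"
      using g(2) by (force simp: image_image)
    then show ?thesis by (simp add: im)
  qed
  have ginj: "inj_on g punctured_disc"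
    using fg by (metis inj_onI)
  have sub: "punctured_disc \<subseteq> ball 0 1"
    by (auto simp: punctured_disc_def)
  obtain F where F: "F holomorphic_on ball 0 1" "\<And>z. z \<in> punctured_disc \<Longrightarrow> F z = f z"
      "F ` ball 0 1 \<subseteq> ball 0 1"
    using injection_extends_across_puncture[OF f] im sub by auto
  obtain G where G: "G holomorphic_on ball 0 1" "\<And>z. z \<in> punctured_disc \<Longrightarrow> G z = g z"
      "G ` ball 0 1 \<subseteq> ball 0 1"
    using injection_extends_across_puncture[OF g(1) ginj] gim sub by auto
  have inv: "G (F z) = z" "F (G z) = z" if "z \<in> punctured_disc" for z
    using that F(2) G(2) g(2) fg im gim by (metis imageI)+
  have F0: "F 0 = 0"
    by (rule bijection_puncture_fixed[OF F(1,3) G(1)]) (use gim G(2) inv in auto)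
  have G0: "G 0 = 0"
    by (rule bijection_puncture_fixed[OF G(1,3) F(1)]) (use im F(2) inv in auto)
  have F_lt: "cmod (F z) < 1" and G_lt: "cmod (G z) < 1" if "cmod z < 1" for z
    using that F(3) G(3) by (auto simp: image_subset_iff)
  have schwarz: "cmod (F z) \<le> cmod z" "cmod (G z) \<le> cmod z" if "cmod z < 1" for z
    using Schwarz_Lemma(1)[OF F(1) F0 F_lt that] Schwarz_Lemma(1)[OF G(1) G0 G_lt that] by simp_all
  define z0 :: complex where "z0 = 1/2"
  have z0: "z0 \<in> punctured_disc"
    by (auto simp: z0_def punctured_disc_def norm_divide)
  then have fz0: "f z0 \<in> punctured_disc"
    using im by auto
  have "cmod z0 \<le> cmod (F z0)"
    using schwarz(2)[of "f z0"] z0 fz0 F(2) G(2) g(2) by (auto simp: punctured_disc_def)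
  then have "cmod (F z0) = cmod z0"
    using schwarz(1)[of z0] z0 by (auto simp: punctured_disc_def)
  then have "\<exists>z. cmod z < 1 \<and> z \<noteq> 0 \<and> cmod (F z) = cmod z"
    using z0 by (auto simp: punctured_disc_def)
  then obtain \<alpha> where \<alpha>: "\<And>z. cmod z < 1 \<Longrightarrow> F z = \<alpha> * z" "cmod \<alpha> = 1"
    using Schwarz_Lemma(3)[OF F(1) F0 F_lt, of 0] by auto
  show thesis
    by (rule that[OF \<alpha>(2)]) (use \<alpha>(1) F(2) in \<open>auto simp: punctured_disc_def\<close>)
qed

section \<open>The winding number of the image of a circle\<close>

definition circle_index :: "real \<Rightarrow> (complex \<Rightarrow> complex) \<Rightarrow> complex" where
  "circle_index r g = winding_number (g \<circ> circlepath 0 r) 0"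

lemma image_of_circle_loop:
  assumes "0 < r" "continuous_on (sphere 0 r) g" "\<forall>z\<in>sphere 0 r. g z \<noteq> 0"
  shows "path (g \<circ> circlepath 0 r)" "0 \<notin> path_image (g \<circ> circlepath 0 r)"
    "pathfinish (g \<circ> circlepath 0 r) = pathstart (g \<circ> circlepath 0 r)"
  using assms by (auto intro!: path_continuous_image simp: path_image_compose pathfinish_compose pathstart_compose)

lemma circlepath_in_sphere:
  assumes "0 < r" "t \<in> {0..1}"
  shows "circlepath 0 r t \<in> sphere 0 r"
proof -
  have "circlepath 0 r t \<in> path_image (circlepath 0 r)"
    using assms(2) by (auto simp: path_image_def)
  then show ?thesis using assms(1) by simp
qed

lemma circle_index_cong:
  assumes "0 < r" "\<And>z. z \<in> sphere 0 r \<Longrightarrow> g z = h z"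
  shows "circle_index r g = circle_index r h"
  unfolding circle_index_def
  by (rule winding_number_cong) (use assms circlepath_in_sphere in auto)

text \<open>Both paths have continuous logarithms, and the sum of these is a logarithm of the product.\<close>
lemma winding_number_mult_paths:
  assumes "path p" "0 \<notin> path_image p" "path q" "0 \<notin> path_image q"
  shows "winding_number (\<lambda>t. p t * q t) 0 = winding_number p 0 + winding_number q 0"
proof -
  obtain P where P: "path P" "pathfinish P - pathstart P = 2 * of_real pi * \<i> * winding_number p 0"
      "\<And>t. t \<in> {0..1} \<Longrightarrow> p t = 0 + exp (P t)"
    using winding_number_as_continuous_log[OF assms(1,2)] by blast
  obtain Q where Q: "path Q" "pathfinish Q - pathstart Q = 2 * of_real pi * \<i> * winding_number q 0"
      "\<And>t. t \<in> {0..1} \<Longrightarrow> q t = 0 + exp (Q t)"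
    using winding_number_as_continuous_log[OF assms(3,4)] by blast
  have "winding_number (\<lambda>t. p t * q t) 0 = winding_number (exp \<circ> (\<lambda>t. P t + Q t)) 0"
    by (rule winding_number_cong) (use P(3) Q(3) in \<open>auto simp: exp_add\<close>)
  also have "\<dots> = (pathfinish (\<lambda>t. P t + Q t) - pathstart (\<lambda>t. P t + Q t)) / (2 * of_real pi * \<i>)"
    using P(1) Q(1) by (intro winding_number_compose_exp) (auto simp: path_def intro: continuous_intros)
  also have "pathfinish (\<lambda>t. P t + Q t) - pathstart (\<lambda>t. P t + Q t)
      = (pathfinish P - pathstart P) + (pathfinish Q - pathstart Q)"
    by (simp add: pathfinish_def pathstart_def)
  finally show ?thesis
    unfolding P(2) Q(2) by (simp add: add_divide_distrib)
qed

lemma circle_index_mult: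
  assumes "0 < r" "continuous_on (sphere 0 r) g" "\<forall>z\<in>sphere 0 r. g z \<noteq> 0"
    "continuous_on (sphere 0 r) h" "\<forall>z\<in>sphere 0 r. h z \<noteq> 0"
  shows "circle_index r (\<lambda>z. g z * h z) = circle_index r g + circle_index r h"
  using winding_number_mult_paths[OF image_of_circle_loop(1,2)[OF assms(1-3)]
      image_of_circle_loop(1,2)[OF assms(1,4,5)]]
  by (simp add: circle_index_def comp_def)

lemma circle_index_const:
  assumes "c \<noteq> 0"
  shows "circle_index r (\<lambda>_. c) = 0"
  using winding_number_compose_exp[of "\<lambda>_. Ln c"] assms
  by (simp add: circle_index_def comp_def path_def pathfinish_def pathstart_def)

lemma circle_index_id:
  assumes "0 < r"
  shows "circle_index r (\<lambda>z. z) = 1"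
  using assms winding_number_circlepath_centre[of r 0] by (simp add: circle_index_def comp_def)

text \<open>Along the circle, a rotation only changes the starting point of the parametrization.\<close>
lemma circle_index_rotate:
  assumes "0 < r" "continuous_on (sphere 0 r) g" "\<forall>z\<in>sphere 0 r. g z \<noteq> 0" "cmod \<alpha> = 1"
  shows "circle_index r (\<lambda>z. g (\<alpha> * z)) = circle_index r g"
proof -
  obtain t where t: "0 \<le> t" "t < 2 * pi" "\<alpha> = exp (\<i> * of_real t)"
    using assms(4) complex_unimodular_polar[of \<alpha>] by (metis cis.code cis_conv_exp)
  define a where "a = t / (2 * pi)"
  have a: "a \<in> {0..1}" "\<alpha> = exp (2 * of_real pi * \<i> * of_real a)"
    using t by (auto simp: a_def mult.commute)
  have shift: "circlepath 0 r (a + s) = \<alpha> * circlepath 0 r s" for s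
    by (simp add: circlepath a(2) exp_add[symmetric] algebra_simps)
  have period: "circlepath 0 r (x - 1) = circlepath 0 r x" for x
    by (simp add: circlepath right_diff_distrib exp_diff)
  have "(\<lambda>z. g (\<alpha> * z)) \<circ> circlepath 0 r = shiftpath a (g \<circ> circlepath 0 r)"
    by (auto simp: shiftpath_def fun_eq_iff period shift)
  then show ?thesis
    using winding_number_shiftpath[OF image_of_circle_loop[OF assms(1-3)] a(1)]
    by (simp add: circle_index_def)
qed

lemma circle_index_close:
  assumes "0 < r" "continuous_on (sphere 0 r) g" "continuous_on (sphere 0 r) h"
    and close: "\<And>z. z \<in> sphere 0 r \<Longrightarrow> cmod (h z - g z) < cmod (g z)"
  shows "circle_index r h = circle_index r g"
proof -
  have "\<forall>z\<in>sphere 0 r. g z \<noteq> 0" "\<forall>z\<in>sphere 0 r. h z \<noteq> 0"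
    using close by fastforce+
  then show ?thesis
    unfolding circle_index_def using assms circlepath_in_sphere image_of_circle_loop
    by (intro winding_number_nearby_loops_eq) auto
qed

text \<open>Each application of the operator multiplies by \<open>\<omega>\<close> and rotates; the rotation leaves the index
  alone and the factor contributes the index of \<open>\<omega>\<close>.\<close>
lemma weighted_rotation_index:
  assumes r: "0 < r" "sphere 0 r \<subseteq> S"
    and \<alpha>: "cmod \<alpha> = 1" "\<And>z. z \<in> S \<Longrightarrow> \<psi> z = \<alpha> * z"
    and \<omega>: "continuous_on (sphere 0 r) \<omega>" "\<forall>z\<in>sphere 0 r. \<omega> z \<noteq> 0"
    and f: "continuous_on (sphere 0 r) f" "\<forall>z\<in>sphere 0 r. f z \<noteq> 0"
  defines "Tf \<equiv> \<lambda>n. (weighted_comp S \<omega> \<psi> ^^ n) f"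
  shows "continuous_on (sphere 0 r) (Tf n) \<and> (\<forall>z\<in>sphere 0 r. Tf n z \<noteq> 0)
    \<and> circle_index r (Tf n) = of_nat n * circle_index r \<omega> + circle_index r f"
proof (induction n)
  case 0
  then show ?case using f by (simp add: Tf_def)
next
  case (Suc n)
  have rot: "(\<lambda>z. \<alpha> * z) ` sphere 0 r \<subseteq> sphere 0 r"
    using \<alpha>(1) by (auto simp: norm_mult)
  have step: "Tf (Suc n) z = \<omega> z * Tf n (\<alpha> * z)" if "z \<in> sphere 0 r" for z
    using that r(2) \<alpha>(2) by (auto simp: Tf_def weighted_comp_def)
  have cont: "continuous_on (sphere 0 r) (\<lambda>z. Tf n (\<alpha> * z))"
    by (rule continuous_on_compose2[of "sphere 0 r" "Tf n"]) (use Suc rot in \<open>auto intro!: continuous_intros\<close>)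
  have nz: "\<forall>z\<in>sphere 0 r. Tf n (\<alpha> * z) \<noteq> 0"
    using Suc rot by blast
  have "circle_index r (Tf (Suc n)) = circle_index r (\<lambda>z. \<omega> z * Tf n (\<alpha> * z))"
    using r(1) step by (rule circle_index_cong)
  also have "\<dots> = circle_index r \<omega> + circle_index r (Tf n)"
    using circle_index_mult[OF r(1) \<omega> cont nz] circle_index_rotate[OF r(1) _ _ \<alpha>(1)] Suc by simp
  finally have "circle_index r (Tf (Suc n)) = of_nat (Suc n) * circle_index r \<omega> + circle_index r f"
    using Suc by (simp add: algebra_simps)
  moreover have "continuous_on (sphere 0 r) (Tf (Suc n))"
    using continuous_on_mult[OF \<omega>(1) cont] by (subst continuous_on_cong[OF refl step]) auto
  moreover have "\<forall>z\<in>sphere 0 r. Tf (Suc n) z \<noteq> 0"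
    using step nz \<omega>(2) by simp
  ultimately show ?case by blast
qed

text \<open>In a compact annulus \<open>f\<close> has only finitely many zeros, while there are infinitely many radii.\<close>
lemma zero_free_circle:
  assumes f: "f holomorphic_on punctured_disc" and nz: "\<exists>z\<in>punctured_disc. f z \<noteq> 0"
  obtains r where "0 < r" "r < 1" "\<forall>z\<in>sphere 0 r. f z \<noteq> 0"
proof -
  define K :: "complex set" where "K = cball 0 (2/3) - ball 0 (1/3)"
  have K: "compact K" "K \<subseteq> punctured_disc"
    by (auto simp: K_def punctured_disc_def compact_diff)
  have "finite {z \<in> K. f z = 0}"
  proof (cases "f constant_on punctured_disc")
    case True
    then have "{z \<in> K. f z = 0} = {}"
      using nz K(2) by (auto simp: constant_on_def)
    then show ?thesis by (simp only: finite.emptyI)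
  next
    case False
    then show ?thesis
      using holomorphic_compact_finite_zeros[OF f open_punctured_disc connected_punctured_disc K]
      by blast
  qed
  then have "finite (cmod ` {z \<in> K. f z = 0})"
    by simp
  then have "\<not> {1/3<..<2/3} \<subseteq> cmod ` {z \<in> K. f z = 0}"
    using finite_subset[of "{1/3<..<2/3::real}"] infinite_Ioo[of "1/3::real" "2/3"] by auto
  then obtain r where "r \<in> {1/3<..<2/3}" and r_free: "r \<notin> cmod ` {z \<in> K. f z = 0}"
    by blast
  then have r: "1/3 < r" "r < 2/3"
    by simp_all
  have "f z \<noteq> 0" if "z \<in> sphere 0 r" for z
    using r r_free that by (auto simp: K_def image_iff)
  with r show thesis
    by (intro that[of r]) auto
qed

section \<open>Weighted composition operators with surjective symbol\<close>

theorem proposition3p2: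
  fixes \<psi> \<omega> :: "complex \<Rightarrow> complex"
  assumes "\<psi> holomorphic_on punctured_disc"
    and "\<psi> ` punctured_disc = punctured_disc"
    and "\<omega> holomorphic_on punctured_disc"
  shows "\<not> supercyclic (\<lambda>c f z. c * f z) (compact_open_topology punctured_disc)
           (weighted_comp punctured_disc \<omega> \<psi>)"
proof
  let ?D = punctured_disc
  let ?T = "weighted_comp ?D \<omega> \<psi>"
  assume "supercyclic (\<lambda>c f z. c * f z) (compact_open_topology ?D) ?T"
  then obtain f where f: "f \<in> holo_space ?D"
      and dense: "compact_open_topology ?D closure_of {\<lambda>z. c * (?T ^^ n) f z | c n. True} = holo_space ?D"
    by (auto simp: supercyclic_def topspace_compact_open_topology)
  have T_Suc: "(?T ^^ n) f z = \<omega> z * (?T ^^ (n - 1)) f (\<psi> z)" if "z \<in> ?D" "1 \<le> n" for n z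
    using that by (cases n) (auto simp: weighted_comp_def)
  have half: "1/2 \<in> ?D" "1/3 \<in> ?D"
    by (auto simp: punctured_disc_def norm_divide)
  have \<omega>_nz: "\<omega> z \<noteq> 0" if z: "z \<in> ?D" for z
  proof
    assume "\<omega> z = 0"
    obtain w where w: "w \<in> ?D" "z \<noteq> w"
      using half by (cases "z = 1/2") (force, blast)
    have "(1::complex) = 0"
      by (rule orbit_two_point_relation_trivial[OF dense open_punctured_disc z w, where b = 0])
         (use z \<open>\<omega> z = 0\<close> in \<open>simp add: T_Suc\<close>)
    then show False by simp
  qed
  have inj: "inj_on \<psi> ?D"
  proof (rule inj_onI, rule ccontr)
    fix z w assume zw: "z \<in> ?D" "w \<in> ?D" "\<psi> z = \<psi> w" "z \<noteq> w"
    have "\<omega> w = 0"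
      by (rule orbit_two_point_relation_trivial[OF dense open_punctured_disc zw(1,2,4), where b = "- \<omega> z"])
         (use zw in \<open>simp add: T_Suc\<close>)
    then show False
      using \<omega>_nz zw(2) by simp
  qed
  obtain \<alpha> where \<alpha>: "cmod \<alpha> = 1" "\<And>z. z \<in> ?D \<Longrightarrow> \<psi> z = \<alpha> * z"
    using punctured_disc_automorphism_rotation[OF assms(1) inj assms(2)] by blast
  have f_nz: "\<exists>z\<in>?D. f z \<noteq> 0"
  proof (rule ccontr)
    assume "\<not> (\<exists>z\<in>?D. f z \<noteq> 0)"
    then have "f = (\<lambda>_. 0)"
      using f by (auto simp: holo_space_def)
    moreover have "?T (\<lambda>_. 0) = (\<lambda>_. 0)"
      by (auto simp: weighted_comp_def)
    ultimately have T0: "(?T ^^ n) f = (\<lambda>_. 0)" for n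
      by (induction n) simp_all
    have "(1::complex) = 0"
      by (rule orbit_two_point_relation_trivial[OF dense open_punctured_disc half, where b = 0]) (simp_all add: T0)
    then show False by simp
  qed
  have f_hol: "f holomorphic_on ?D"
    using f by (simp add: holo_space_def)
  obtain r where r: "0 < r" "r < 1" "\<forall>z\<in>sphere 0 r. f z \<noteq> 0"
    using zero_free_circle[OF f_hol f_nz] by blast
  have sub: "sphere 0 r \<subseteq> ?D"
    using r by (auto simp: punctured_disc_def)
  have cont: "continuous_on (sphere 0 r) g" if "g holomorphic_on ?D" for g
    using that sub holomorphic_on_imp_continuous_on continuous_on_subset by blast
  have \<omega>: "continuous_on (sphere 0 r) \<omega>" "\<forall>z\<in>sphere 0 r. \<omega> z \<noteq> 0"
    using cont assms(3) \<omega>_nz sub by auto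
  \<comment> \<open>Approximation within the minimum of \<open>cmod \<circ> g\<close> on the circle preserves the index of \<open>g\<close>.\<close>
  have index: "\<exists>n. circle_index r g = of_nat n * circle_index r \<omega> + circle_index r f"
    if g: "g holomorphic_on ?D" "\<forall>z\<in>sphere 0 r. g z \<noteq> 0" for g
  proof -
    have "(\<lambda>z. if z \<in> ?D then g z else 0) \<in> holo_space ?D"
      using g(1) by (auto simp: holo_space_def intro: holomorphic_transform)
    moreover obtain e where e: "0 < e" "\<And>z. z \<in> sphere 0 r \<Longrightarrow> e \<le> cmod (g z)"
    proof -
      have "\<exists>z\<in>sphere 0 r. \<forall>y\<in>sphere 0 r. cmod (g z) \<le> cmod (g y)"
        using r(1) cont[OF g(1)] by (intro continuous_attains_inf) (auto intro!: continuous_intros)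
      then obtain z where z: "z \<in> sphere 0 r" "\<And>y. y \<in> sphere 0 r \<Longrightarrow> cmod (g z) \<le> cmod (g y)"
        by blast
      show thesis
        by (rule that[of "cmod (g z)"]) (use g(2) z in auto)
    qed
    ultimately obtain h where h: "h \<in> {\<lambda>z. c * (?T ^^ n) f z | c n. True}"
        "\<And>z. z \<in> sphere 0 r \<Longrightarrow> cmod (h z - (if z \<in> ?D then g z else 0)) < e"
      using compact_open_approximation[OF dense _ compact_sphere sub] by blast
    then obtain c n where cn: "h = (\<lambda>z. c * (?T ^^ n) f z)"
      by auto
    have close: "cmod (c * (?T ^^ n) f z - g z) < cmod (g z)" if "z \<in> sphere 0 r" for z
      using h(2)[OF that] e(2)[OF that] sub that by (auto simp: cn)
    have "of_real r \<in> sphere (0::complex) r"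
      using r(1) by simp
    then have c: "c \<noteq> 0"
      using close[of "of_real r"] by auto
    note Tn = weighted_rotation_index[where \<psi> = \<psi>, OF r(1) sub \<alpha> \<omega> cont[OF f_hol] r(3), of n]
    have "circle_index r g = circle_index r (\<lambda>z. c * (?T ^^ n) f z)"
      using Tn close cont[OF g(1)] r(1)
      by (intro circle_index_close[symmetric]) (auto intro!: continuous_intros)
    also have "\<dots> = circle_index r (\<lambda>_. c) + circle_index r ((?T ^^ n) f)"
      using Tn c r(1) by (intro circle_index_mult) auto
    finally show ?thesis
      using Tn circle_index_const[OF c] by auto
  qed
  obtain n where n: "circle_index r (\<lambda>z. f z / \<omega> z) = of_nat n * circle_index r \<omega> + circle_index r f"
    using index[of "\<lambda>z. f z / \<omega> z"] f_hol assms(3) r(3) \<omega>(2) \<omega>_nz by (auto intro!: holomorphic_intros)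
  have "circle_index r f = circle_index r (\<lambda>z. \<omega> z * (f z / \<omega> z))"
    by (rule circle_index_cong[OF r(1)]) (use \<omega>(2) in simp)
  also have "\<dots> = circle_index r \<omega> + circle_index r (\<lambda>z. f z / \<omega> z)"
    using \<omega> r cont[OF f_hol] by (intro circle_index_mult) (auto intro!: continuous_intros)
  finally have "of_nat (Suc n) * circle_index r \<omega> = 0"
    by (simp add: n algebra_simps)
  then have \<omega>_index: "circle_index r \<omega> = 0"
    by (simp only: mult_eq_0_iff of_nat_eq_0_iff) simp
  obtain m where "circle_index r (\<lambda>z. z * f z) = of_nat m * circle_index r \<omega> + circle_index r f"
    using index[of "\<lambda>z. z * f z"] f_hol r by (force intro!: holomorphic_intros)
  moreover have "circle_index r (\<lambda>z. z * f z) = 1 + circle_index r f"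
  proof -
    have "\<forall>z\<in>sphere (0::complex) r. z \<noteq> 0"
      using r(1) by auto
    then show ?thesis
      using circle_index_mult[OF r(1) continuous_on_id _ cont[OF f_hol] r(3)] circle_index_id[OF r(1)]
      by simp
  qed
  ultimately show False
    using \<omega>_index by simp
qed

end
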